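(* Let $\Sigma$ be a signed graph with vertex set $V(G)$, and suppose that the largest eigenvalue $\lambda_1(\Sigma)$ of $A(\Sigma)$ has an associated non-negative eigenvector $x$. Let $S=\{u\in V(G):x_u>0\}$. Then for every integer $k\ge1$, \[\lambda_1^k(\Sigma)\le\max\{s_k(i): i\in S\}.\]
   Context: A signed graph $\Sigma=(G,\sigma)$ is a finite simple graph $G$ with a sign function $\sigma:E(G)\to\{-1,+1\}$; its adjacency matrix $A=A(\Sigma)$ has $(i,j)$ entry $\sigma(ij)$ if $i\sim j$ and $0$ otherwise. The sign of a walk is the product of the signs of its edges (with multiplicity). $w_k^+(i)$ and $w_k^-(i)$ denote the numbers of positive and negative walks of length $k$ originating from vertex $i$, and $s_k(i)=w_k^+(i)-w_k^-(i)=(A^k\mathbf 1)_i$, where $\mathbf 1$ is the all-ones vector. A vector is non-negative if all its entries are non-negative. *)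

theory Defs
  imports "HOL-Analysis.Analysis"
begin

(* The vertex set is the whole (finite, nonempty) type 'v.  A simple graph on it is given by its
   set of edges, an edge being an unordered pair of distinct vertices.  The values of sg outside
   the edge set are irrelevant. *)
definition signed_graph :: "'v::finite set set \<Rightarrow> ('v set \<Rightarrow> int) \<Rightarrow> bool" where
  "signed_graph E sg \<longleftrightarrow> (\<forall>e\<in>E. card e = 2) \<and> (\<forall>e\<in>E. sg e \<in> {-1, 1})"

definition adj_matrix :: "'v::finite set set \<Rightarrow> ('v set \<Rightarrow> int) \<Rightarrow> real^'v^'v" where
  "adj_matrix E sg = (\<chi> i j. if {i, j} \<in> E then real_of_int (sg {i, j}) else 0)"

(* HOL-Analysis has no eigenvectors for the type real^'n^'n. *)
definition is_eigenvector :: "real^'n^'n \<Rightarrow> real \<Rightarrow> real^'n \<Rightarrow> bool" where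
  "is_eigenvector A l x \<longleftrightarrow> x \<noteq> 0 \<and> A *v x = l *\<^sub>R x"

definition is_eigenvalue :: "real^'n^'n \<Rightarrow> real \<Rightarrow> bool" where
  "is_eigenvalue A l \<longleftrightarrow> (\<exists>x. is_eigenvector A l x)"

(* Adjacency matrices are real symmetric: all their eigenvalues are real and there is at least
   one, so this is the maximum of a finite nonempty set. *)
definition lambda1 :: "'v::finite set set \<Rightarrow> ('v set \<Rightarrow> int) \<Rightarrow> real" where
  "lambda1 E sg = Max {l. is_eigenvalue (adj_matrix E sg) l}"

(* As the graph is simple, a walk is determined by its sequence of vertices; a walk of length k
   has k + 1 vertices. *)
definition walks :: "'v::finite set set \<Rightarrow> nat \<Rightarrow> 'v \<Rightarrow> 'v list set" where
  "walks E k i = {p. length p = Suc k \<and> hd p = i \<and> (\<forall>m<k. {p ! m, p ! Suc m} \<in> E)}"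

definition walk_sign :: "('v set \<Rightarrow> int) \<Rightarrow> 'v list \<Rightarrow> int" where
  "walk_sign sg p = (\<Prod>m<length p - 1. sg {p ! m, p ! Suc m})"

definition pos_walks :: "'v::finite set set \<Rightarrow> ('v set \<Rightarrow> int) \<Rightarrow> nat \<Rightarrow> 'v \<Rightarrow> nat" where
  "pos_walks E sg k i = card {p \<in> walks E k i. walk_sign sg p = 1}"

definition neg_walks :: "'v::finite set set \<Rightarrow> ('v set \<Rightarrow> int) \<Rightarrow> nat \<Rightarrow> 'v \<Rightarrow> nat" where
  "neg_walks E sg k i = card {p \<in> walks E k i. walk_sign sg p = -1}"

definition walk_diff :: "'v::finite set set \<Rightarrow> ('v set \<Rightarrow> int) \<Rightarrow> nat \<Rightarrow> 'v \<Rightarrow> int" where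
  "walk_diff E sg k i = int (pos_walks E sg k i) - int (neg_walks E sg k i)"

end

theory Submission
  imports Defs
begin

text \<open>
  Let \<open>A\<close> be the adjacency matrix and write \<open>s k i\<close> for the surplus of positive over negative
  walks of length \<open>k\<close> from \<open>i\<close>.
  Splitting off the first edge of a walk shows that the vector \<open>s k\<close> is \<open>A\<^sup>k\<close> applied to the
  all-ones vector.  As \<open>A\<close> is symmetric, powers of \<open>A\<close> can be moved across the inner product:
  if \<open>A x = l x\<close>, then \<open>\<Sum>i. s k i * x i = l ^ k * (\<Sum>i. x i)\<close>
  (lemma \<open>sum_walk_diff_eigenvector\<close>).  For a non-negative \<open>x \<noteq> 0\<close>, this says that \<open>l ^ k\<close> is
  the average of the numbers \<open>s k i\<close> with weights \<open>x i\<close>.  Only the support of \<open>x\<close> carries weight,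
  and an average is at most the largest of the values averaged.
\<close>

lemma finite_walks: "finite (walks E k i)"
proof (rule finite_subset)
  show "walks E k i \<subseteq> {p. set p \<subseteq> UNIV \<and> length p = Suc k}"
    by (auto simp: walks_def)
  show "finite {p :: 'a list. set p \<subseteq> UNIV \<and> length p = Suc k}"
    by (rule finite_lists_length_eq) simp
qed

lemma walk_sign_cases:
  assumes "signed_graph E sg" and "p \<in> walks E k i"
  shows "walk_sign sg p = 1 \<or> walk_sign sg p = -1"
proof -
  have "\<bar>sg {p ! m, p ! Suc m}\<bar> = 1" if "m < k" for m
  proof -
    have "{p ! m, p ! Suc m} \<in> E"
      using assms(2) that by (simp add: walks_def)
    then have "sg {p ! m, p ! Suc m} \<in> {-1, 1}"
      using assms(1) unfolding signed_graph_def by blast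
    then show ?thesis by auto
  qed
  then have "\<bar>walk_sign sg p\<bar> = 1"
    using assms(2) by (simp add: walk_sign_def walks_def abs_prod)
  then show ?thesis by linarith
qed

lemma walk_diff_eq_sum_walk_sign:
  assumes "signed_graph E sg"
  shows "walk_diff E sg k i = (\<Sum>p\<in>walks E k i. walk_sign sg p)"
proof -
  let ?P = "{p \<in> walks E k i. walk_sign sg p = 1}"
  let ?N = "{p \<in> walks E k i. walk_sign sg p = -1}"
  have "walks E k i = ?P \<union> ?N"
    using walk_sign_cases[OF assms] by blast
  then have "(\<Sum>p\<in>walks E k i. walk_sign sg p) = (\<Sum>p\<in>?P \<union> ?N. walk_sign sg p)"
    by simp
  also have "\<dots> = (\<Sum>p\<in>?P. walk_sign sg p) + (\<Sum>p\<in>?N. walk_sign sg p)"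
    by (rule sum.union_disjoint) (auto simp: finite_walks)
  also have "\<dots> = int (card ?P) - int (card ?N)"
    by simp
  finally show ?thesis
    by (simp add: walk_diff_def pos_walks_def neg_walks_def)
qed

lemma walks_0: "walks E 0 i = {[i]}"
  by (auto simp: walks_def length_Suc_conv)

lemma walks_Suc:
  "walks E (Suc k) i = (\<Union>j\<in>{j. {i, j} \<in> E}. (#) i ` walks E k j)" (is "?L = ?R")
proof
  show "?L \<subseteq> ?R"
  proof
    fix p assume p: "p \<in> ?L"
    then obtain q where q: "p = i # q" "length q = Suc k"
      by (auto simp: walks_def length_Suc_conv)
    have edges: "{p ! m, p ! Suc m} \<in> E" if "m < Suc k" for m
      using p that by (simp add: walks_def)
    have "{i, hd q} \<in> E"
      using edges[of 0] q by (cases q) auto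
    moreover have "q \<in> walks E k (hd q)"
      using q edges[of "Suc _"] by (auto simp: walks_def)
    ultimately show "p \<in> ?R"
      using q by blast
  qed
  show "?R \<subseteq> ?L"
  proof -
    have "i # q \<in> ?L" if "{i, j} \<in> E" "q \<in> walks E k j" for q j
    proof -
      have "hd q = q ! 0"
        using that(2) by (cases q) (auto simp: walks_def)
      then show ?thesis
        using that by (auto simp: walks_def nth_Cons split: nat.split)
    qed
    then show ?thesis by blast
  qed
qed

lemma walk_sign_Cons:
  assumes "q \<noteq> []"
  shows "walk_sign sg (i # q) = sg {i, hd q} * walk_sign sg q"
proof -
  obtain n where n: "length q = Suc n"
    using assms by (cases q) auto
  have "walk_sign sg (i # q) = (\<Prod>m<Suc n. sg {(i # q) ! m, (i # q) ! Suc m})"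
    using n by (simp add: walk_sign_def)
  also have "\<dots> = sg {i, hd q} * walk_sign sg q"
    using n assms by (subst prod.lessThan_Suc_shift) (simp add: walk_sign_def hd_conv_nth)
  finally show ?thesis .
qed

lemma walk_diff_0:
  assumes "signed_graph E sg"
  shows "walk_diff E sg 0 i = 1"
  by (simp add: walk_diff_eq_sum_walk_sign[OF assms] walks_0 walk_sign_def)

text \<open>
  The first edge of a walk contributes its sign as a factor and leaves a walk that is one step
  shorter, starting at the other end of that edge.
\<close>
lemma walk_diff_Suc:
  assumes "signed_graph E sg"
  shows "real_of_int (walk_diff E sg (Suc k) i) =
    (\<Sum>j\<in>UNIV. adj_matrix E sg $ i $ j * real_of_int (walk_diff E sg k j))"
proof -
  have hd: "q \<noteq> [] \<and> hd q = j" if "q \<in> walks E k j" for q j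
    using that by (auto simp: walks_def)
  have "walk_diff E sg (Suc k) i =
      (\<Sum>j\<in>{j. {i, j} \<in> E}. \<Sum>p\<in>(#) i ` walks E k j. walk_sign sg p)"
    unfolding walk_diff_eq_sum_walk_sign[OF assms] walks_Suc
    by (rule sum.UNION_disjoint) (auto simp: finite_walks dest: hd)
  also have "\<dots> = (\<Sum>j\<in>{j. {i, j} \<in> E}. sg {i, j} * walk_diff E sg k j)"
    by (intro sum.cong refl)
      (auto simp: sum.reindex walk_diff_eq_sum_walk_sign[OF assms] sum_distrib_left
        walk_sign_Cons hd intro!: sum.cong)
  also have "\<dots> = (\<Sum>j\<in>UNIV. if {i, j} \<in> E then sg {i, j} * walk_diff E sg k j else 0)"
    by (simp add: sum.If_cases)
  finally have "real_of_int (walk_diff E sg (Suc k) i) =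
      (\<Sum>j\<in>UNIV. real_of_int (if {i, j} \<in> E then sg {i, j} * walk_diff E sg k j else 0))"
    by (simp only: of_int_sum)
  also have "\<dots> = (\<Sum>j\<in>UNIV. adj_matrix E sg $ i $ j * real_of_int (walk_diff E sg k j))"
    by (intro sum.cong refl) (simp add: adj_matrix_def)
  finally show ?thesis .
qed

lemma adj_matrix_symmetric: "adj_matrix E sg $ i $ j = adj_matrix E sg $ j $ i"
  by (simp add: adj_matrix_def insert_commute)

text \<open>
  This is \<open>(A\<^sup>k 1) \<bullet> x = 1 \<bullet> (A\<^sup>k x)\<close>, obtained by moving one factor \<open>A\<close> at a time from the
  vector of walk surpluses to the eigenvector.
\<close>
lemma sum_walk_diff_eigenvector:
  assumes "signed_graph E sg" and "is_eigenvector (adj_matrix E sg) l x"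
  shows "(\<Sum>i\<in>UNIV. real_of_int (walk_diff E sg k i) * x $ i) = l ^ k * (\<Sum>i\<in>UNIV. x $ i)"
proof (induction k)
  case 0
  then show ?case by (simp add: walk_diff_0[OF assms(1)])
next
  case (Suc k)
  let ?A = "adj_matrix E sg" and ?s = "\<lambda>j. real_of_int (walk_diff E sg k j)"
  have eig: "(\<Sum>i\<in>UNIV. ?A $ j $ i * x $ i) = l * x $ j" for j
  proof -
    have "(?A *v x) $ j = (l *\<^sub>R x) $ j"
      using assms(2) by (simp add: is_eigenvector_def)
    then show ?thesis by (simp add: matrix_vector_mult_def)
  qed
  have "(\<Sum>i\<in>UNIV. real_of_int (walk_diff E sg (Suc k) i) * x $ i)
      = (\<Sum>i\<in>UNIV. \<Sum>j\<in>UNIV. ?A $ i $ j * ?s j * x $ i)"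
    by (simp add: walk_diff_Suc[OF assms(1)] sum_distrib_right)
  also have "\<dots> = (\<Sum>j\<in>UNIV. \<Sum>i\<in>UNIV. ?A $ i $ j * ?s j * x $ i)"
    by (rule sum.swap)
  also have "\<dots> = (\<Sum>j\<in>UNIV. ?s j * (\<Sum>i\<in>UNIV. ?A $ j $ i * x $ i))"
    unfolding sum_distrib_left
    by (intro sum.cong refl) (simp, metis adj_matrix_symmetric)
  also have "\<dots> = l * (\<Sum>j\<in>UNIV. ?s j * x $ j)"
    unfolding eig by (simp add: sum_distrib_left mult_ac)
  finally show ?case
    by (simp add: Suc.IH)
qed

theorem theorem5p6:
  fixes E :: "'v::finite set set" and sg :: "'v set \<Rightarrow> int"
    and x :: "real^'v" and S :: "'v set" and k :: nat
  assumes "signed_graph E sg"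
    and "is_eigenvector (adj_matrix E sg) (lambda1 E sg) x"
    and "\<And>u. x $ u \<ge> 0"
    and "S = {u. x $ u > 0}"
    and "k \<ge> 1"
  shows "lambda1 E sg ^ k \<le> real_of_int (Max {walk_diff E sg k i | i. i \<in> S})"
proof -
  define M where "M = Max {walk_diff E sg k i | i. i \<in> S}"
  have le: "walk_diff E sg k i \<le> M" if "i \<in> S" for i
    unfolding M_def using that by (intro Max_ge) auto
  have pos: "(\<Sum>i\<in>UNIV. x $ i) > 0"
  proof -
    obtain u where "x $ u \<noteq> 0"
      using assms(2) by (auto simp: is_eigenvector_def vec_eq_iff)
    with assms(3)[of u] have "x $ u > 0" by simp
    then show ?thesis
      using assms(3) by (intro sum_pos2[of UNIV u]) auto
  qed
  have "lambda1 E sg ^ k * (\<Sum>i\<in>UNIV. x $ i)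
      = (\<Sum>i\<in>UNIV. real_of_int (walk_diff E sg k i) * x $ i)"
    by (simp add: sum_walk_diff_eigenvector[OF assms(1,2)])
  also have "\<dots> \<le> (\<Sum>i\<in>UNIV. real_of_int M * x $ i)"
  proof (rule sum_mono)
    fix i
    show "real_of_int (walk_diff E sg k i) * x $ i \<le> real_of_int M * x $ i"
    proof (cases "i \<in> S")
      case True
      then show ?thesis
        using le assms(3) by (intro mult_right_mono) auto
    next
      case False
      then have "x $ i = 0"
        using assms(3)[of i] assms(4) by simp
      then show ?thesis by simp
    qed
  qed
  also have "\<dots> = real_of_int M * (\<Sum>i\<in>UNIV. x $ i)"
    by (simp add: sum_distrib_left)
  finally show ?thesis
    using pos unfolding M_def by simp
qed

end
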